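(* For every integer $r\ge 2$, the set $$L_r=\{n(r+2)^k : n\in\{1,2,\ldots,r\},\ k\in\mathbb{Z},\ k\ge 0\}\subset\mathbb{N}$$ (a) is lacunary; (b) is stably $r$-Birkhoff; and (c) is not $(r+1)$-Birkhoff.
   Context: For a positive integer $s$, a set $L\subset\mathbb{Z}\setminus\{0\}$ is $s$-Birkhoff if for every sequence $\{z_i\}_{i\in\mathbb{Z}}$ with values in $\{1,2,\dots,s\}$ there are $m\in L$ and $i\in\mathbb{Z}$ such that $z_i=z_{i+m}$. A set $M\subset\mathbb{Z}\setminus\{0\}$ is stably $s$-Birkhoff if for every finite $F\subset\mathbb{Z}$ the set $M\setminus F$ is $s$-Birkhoff. An infinite set of positive integers, listed increasingly as $x_1<x_2<\cdots$, is lacunary if $\inf_{k\ge1} x_{k+1}/x_k>1$. *)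

theory Defs
  imports Complex_Main "HOL-Library.Infinite_Set"
begin

(* The notion is meant for s \<ge> 1 and L not containing 0; these ambient conditions are not built
   into the predicate, so that its negation really asserts the existence of a bad sequence. *)
definition birkhoff :: "nat \<Rightarrow> int set \<Rightarrow> bool" where
  "birkhoff s L \<longleftrightarrow>
     (\<forall>z :: int \<Rightarrow> nat. range z \<subseteq> {1..s} \<longrightarrow> (\<exists>m\<in>L. \<exists>i. z i = z (i + m)))"

definition stably_birkhoff :: "nat \<Rightarrow> int set \<Rightarrow> bool" where
  "stably_birkhoff s M \<longleftrightarrow> (\<forall>F. finite F \<longrightarrow> birkhoff s (M - F))"

(* For infinite X, enumerate X lists X increasingly, starting at index 0. The ratios are
   nonnegative, so the infimum over all k is a genuine one. *)
definition lacunary :: "nat set \<Rightarrow> bool" where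
  "lacunary X \<longleftrightarrow> infinite X \<and> 0 \<notin> X \<and>
     (INF k. real (enumerate X (Suc k)) / real (enumerate X k)) > 1"

definition Lset :: "nat \<Rightarrow> nat set" where
  "Lset r = {n * (r + 2) ^ k | n k. n \<in> {1..r}}"

end

theory Submission
  imports Defs
begin

(* Each scale (r + 2)^k contributes a full block of differences 1, ..., r, so pigeonhole on the
   r + 1 points 0, (r + 2)^k, ..., r (r + 2)^k gives the Birkhoff property at arbitrarily large
   scales. Conversely r + 2 is congruent to 1 modulo r + 1, so no element of L_r is divisible by
   r + 1 and residues modulo r + 1 are a bad colouring. *)

lemma zero_notin_Lset: "0 \<notin> Lset r"
  by (auto simp: Lset_def)

lemma infinite_Lset:
  assumes "r \<ge> 1"
  shows "infinite (Lset r)"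
proof -
  have "inj (\<lambda>k. (r + 2) ^ k)"
    by (auto simp: inj_on_def)
  then have "infinite (range (\<lambda>k. (r + 2) ^ k))"
    by (rule range_inj_infinite)
  moreover have "range (\<lambda>k. (r + 2) ^ k) \<subseteq> Lset r"
    using assms by (force simp: Lset_def)
  ultimately show ?thesis
    using infinite_super by blast
qed

text \<open>At equal scales \<open>n < m\<close> and \<open>n \<le> r\<close> give
  \<open>m / n \<ge> 1 + 1 / r\<close>; at a higher scale the ratio is at least
  \<open>(r + 2) / r\<close>. Both exceed \<open>(r + 1) / r\<close>, or reach it, and clearing
  denominators keeps the bound in \<open>nat\<close>. As it covers arbitrary pairs, the successor of
  an element never has to be identified.\<close>

lemma Lset_gap:
  assumes x: "x \<in> Lset r" and y: "y \<in> Lset r" and "x < y"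
  shows "(r + 1) * x \<le> r * y"
proof -
  obtain n k where n: "n \<in> {1..r}" and xn: "x = n * (r + 2) ^ k"
    using x by (auto simp: Lset_def)
  obtain m j where m: "m \<in> {1..r}" and ym: "y = m * (r + 2) ^ j"
    using y by (auto simp: Lset_def)
  consider "j < k" | "j = k" | "k < j" by linarith
  then show ?thesis
  proof cases
    case 1
    \<comment> \<open>This case is impossible: a block ends before the next power of
      \<open>r + 2\<close>, which would force \<open>y \<le> x\<close>.\<close>
    have "y \<le> (r + 2) * (r + 2) ^ j"
      unfolding ym using m by (intro mult_right_mono) auto
    also have "\<dots> = (r + 2) ^ Suc j"
      by simp
    also have "\<dots> \<le> (r + 2) ^ k"
      using 1 by (intro power_increasing) auto
    also have "\<dots> \<le> x"
      using n by (auto simp: xn)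
    finally show ?thesis
      using \<open>x < y\<close> by simp
  next
    case 2
    have "n < m"
      using \<open>x < y\<close> by (simp add: xn ym 2)
    then have "r * Suc n \<le> r * m"
      by (intro mult_left_mono) auto
    then have "(r + 1) * n \<le> r * m"
      using n by simp
    then have "(r + 1) * n * (r + 2) ^ k \<le> r * m * (r + 2) ^ k"
      by (rule mult_right_mono) simp
    then show ?thesis
      by (simp only: xn ym 2 mult.assoc)
  next
    case 3
    \<comment> \<open>Rounding \<open>r + 1\<close> up to \<open>r + 2\<close> lets the factor be
      absorbed into the next power.\<close>
    have "(r + 1) * x \<le> (r + 2) * (r * (r + 2) ^ k)"
      unfolding xn using n by (intro mult_mono) auto
    also have "\<dots> = r * (r + 2) ^ Suc k"
      by (simp add: algebra_simps)
    also have "\<dots> \<le> r * (r + 2) ^ j"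
      using 3 by (intro mult_left_mono power_increasing) auto
    also have "\<dots> \<le> r * y"
      using m by (auto simp: ym)
    finally show ?thesis .
  qed
qed

lemma lacunary_Lset:
  assumes "r \<ge> 1"
  shows "lacunary (Lset r)"
proof -
  \<comment> \<open>A lower bound independent of \<open>k\<close> is essential: ratios that merely
    exceed 1 could have infimum 1.\<close>
  have "(real r + 1) / real r \<le>
      real (enumerate (Lset r) (Suc k)) / real (enumerate (Lset r) k)" for k
  proof -
    let ?x = "enumerate (Lset r) k" and ?y = "enumerate (Lset r) (Suc k)"
    have "?x \<in> Lset r" "?y \<in> Lset r" "?x < ?y"
      using infinite_Lset[OF assms] by (auto simp: enumerate_in_set intro: enumerate_step)
    then have "real ((r + 1) * ?x) \<le> real (r * ?y)" and "?x > 0"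
      using Lset_gap zero_notin_Lset by (metis of_nat_mono, metis gr0I)
    then show ?thesis
      using assms by (simp add: field_simps)
  qed
  then have "(real r + 1) / real r \<le>
      (INF k. real (enumerate (Lset r) (Suc k)) / real (enumerate (Lset r) k))"
    by (intro cINF_greatest) auto
  moreover have "1 < (real r + 1) / real r"
    using assms by simp
  ultimately show ?thesis
    using infinite_Lset[OF assms] zero_notin_Lset by (simp add: lacunary_def)
qed

lemma birkhoff_multiples:
  assumes L: "\<And>n. n \<in> {1..s} \<Longrightarrow> int n * d \<in> L"
  shows "birkhoff s L"
  unfolding birkhoff_def
proof (intro allI impI)
  fix z :: "int \<Rightarrow> nat"
  assume z: "range z \<subseteq> {1..s}"
  have "(\<lambda>a. z (int a * d)) ` {0..s} \<subseteq> {1..s}"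
    using z by blast
  then have "card ((\<lambda>a. z (int a * d)) ` {0..s}) \<le> s"
    using card_mono[of "{1..s}"] by fastforce
  then have "\<not> inj_on (\<lambda>a. z (int a * d)) {0..s}"
    by (intro pigeonhole) simp
  \<comment> \<open>The colliding indices may be ordered by symmetry, so that \<open>b - a\<close>
    lies in \<open>{1..s}\<close>.\<close>
  then obtain a b where ab: "a \<le> s" "b \<le> s" "a < b" "z (int a * d) = z (int b * d)"
    unfolding inj_on_def by (metis atLeastAtMost_iff nat_neq_iff)
  have "int (b - a) * d \<in> L"
    using ab by (intro L) auto
  moreover have "int a * d + int (b - a) * d = int b * d"
    using ab by (simp add: of_nat_diff algebra_simps)
  ultimately show "\<exists>m\<in>L. \<exists>i. z i = z (i + m)"
    using ab(4) by metis
qed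

lemma stably_birkhoff_Lset: "stably_birkhoff r (int ` Lset r)"
  unfolding stably_birkhoff_def
proof (intro allI impI)
  fix F :: "int set"
  assume "finite F"
  then obtain B where B: "\<And>f. f \<in> F \<Longrightarrow> f \<le> B"
    using bdd_above_finite[of F] by (auto simp: bdd_above_def)
  \<comment> \<open>Since \<open>(r + 2) ^ k > k \<ge> B\<close>, the whole block at scale
    \<open>k\<close> lies above \<open>F\<close>; \<open>nat\<close> also covers a negative
    \<open>B\<close>.\<close>
  define k where "k = nat B"
  have large: "B < int ((r + 2) ^ k)"
  proof -
    have "k < (r + 2) ^ k"
      by (rule power_gt_expt) simp
    then show ?thesis
      unfolding k_def by linarith
  qed
  show "birkhoff r (int ` Lset r - F)"
  proof (rule birkhoff_multiples)
    fix n
    assume n: "n \<in> {1..r}"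
    have "n * (r + 2) ^ k \<in> Lset r"
      using n by (auto simp: Lset_def)
    then have "int (n * (r + 2) ^ k) \<in> int ` Lset r"
      by (rule imageI)
    moreover have "(r + 2) ^ k \<le> n * (r + 2) ^ k"
      using n by simp
    then have "int ((r + 2) ^ k) \<le> int (n * (r + 2) ^ k)"
      by (rule of_nat_mono)
    then have "int (n * (r + 2) ^ k) \<notin> F"
      using large B less_le_trans not_le by blast
    ultimately show "int n * int ((r + 2) ^ k) \<in> int ` Lset r - F"
      by (simp only: of_nat_mult Diff_iff simp_thms)
  qed
qed

text \<open>Consecutive integers are coprime, so the power of \<open>r + 2\<close> cancels, leaving
  \<open>0 < n < r + 1\<close>.\<close>

lemma not_dvd_Lset:
  assumes "x \<in> Lset r"
  shows "\<not> (r + 1) dvd x"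
proof -
  obtain n k where n: "n \<in> {1..r}" and x: "x = n * (r + 2) ^ k"
    using assms by (auto simp: Lset_def)
  have "coprime (r + 1) (r + 2)"
    using coprime_Suc_right_nat[of "r + 1"] by simp
  then have "coprime (r + 1) ((r + 2) ^ k)"
    by simp
  then have "(r + 1) dvd x \<longleftrightarrow> (r + 1) dvd n"
    unfolding x by (rule coprime_dvd_mult_left_iff)
  then show ?thesis
    using n by (auto dest: dvd_imp_le)
qed

lemma not_birkhoff_if_not_dvd:
  assumes "s \<ge> 1" and L: "\<And>m. m \<in> L \<Longrightarrow> \<not> int s dvd m"
  shows "\<not> birkhoff s L"
proof
  assume "birkhoff s L"
  \<comment> \<open>The shift by 1 moves the residues from \<open>{0..s - 1}\<close> to the palette
    \<open>{1..s}\<close>; equal colours at \<open>i\<close> and \<open>i + m\<close> then mean that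
    \<open>s\<close> divides \<open>m\<close>.\<close>
  define z where "z i = nat (i mod int s) + 1" for i :: int
  have "z i \<in> {1..s}" for i
  proof -
    have "i mod int s < int s"
      using assms(1) by simp
    then show ?thesis
      using assms(1) by (simp add: z_def Suc_le_eq nat_less_iff)
  qed
  then obtain m i where m: "m \<in> L" and "z i = z (i + m)"
    using \<open>birkhoff s L\<close> unfolding birkhoff_def by blast
  then have "(i + m) mod int s = i mod int s"
    using assms(1) by (simp add: z_def eq_nat_nat_iff)
  then have "int s dvd m"
    by (simp add: mod_eq_dvd_iff)
  with L[OF m] show False ..
qed

theorem mainTheorem4:
  fixes r :: nat
  assumes "r \<ge> 2"
  shows "lacunary (Lset r) \<and>
         stably_birkhoff r (int ` Lset r) \<and>
         \<not> birkhoff (r + 1) (int ` Lset r)"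
proof (intro conjI)
  show "lacunary (Lset r)"
    using assms by (intro lacunary_Lset) simp
  show "stably_birkhoff r (int ` Lset r)"
    by (rule stably_birkhoff_Lset)
  have "\<not> int (r + 1) dvd m" if "m \<in> int ` Lset r" for m
    using that not_dvd_Lset by (metis imageE int_dvd_int_iff)
  then show "\<not> birkhoff (r + 1) (int ` Lset r)"
    by (intro not_birkhoff_if_not_dvd) simp
qed

end
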